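(* Let $R\in\mathbb{C}^{M\times M}$ be self-adjoint, let $\mathcal{B}\subseteq\mathbb{C}^{M\times M}$ be a linear subspace, and let $L_R^{\mathcal{B}}=P_{\mathcal{B}}\,\mathrm{ad}_R^2|_{\mathcal{B}}:\mathcal{B}\to\mathcal{B}$ be the compressed double-commutator operator. Suppose $L_R^{\mathcal{B}}$ has a one-dimensional kernel $\operatorname{span}\{A_0\}$, $\|A_0\|_F=1$, separated from the rest of its spectrum by a gap $\gamma>0$. Let $\widehat R=R+E$ with $E$ self-adjoint, and let $\widehat A$ be a unit-norm ($\|\widehat A\|_F=1$) minimizer of $\|[\widehat R,A]\|_F^2$ over unit-norm $A\in\mathcal{B}$. If $8\|R\|_2\|E\|_2+4\|E\|_2^2<\gamma/2$, then $$\sin\angle(\widehat A,A_0)\le\frac{8\|R\|_2\|E\|_2+4\|E\|_2^2}{\gamma-8\|R\|_2\|E\|_2-4\|E\|_2^2}.$$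
   Context: $[X,Y]=XY-YX$, $\mathrm{ad}_R^2(A)=[R,[R,A]]$. $\langle X,Y\rangle_F=\operatorname{Tr}(X^HY)$ is the Frobenius inner product with norm $\|\cdot\|_F$; $\|\cdot\|_2$ is the operator norm. $P_{\mathcal{B}}$ is the Frobenius-orthogonal projection onto $\mathcal{B}$. The operator $L_R^{\mathcal{B}}$ is self-adjoint positive semidefinite with $\langle A,L_R^{\mathcal{B}}A\rangle_F=\|[R,A]\|_F^2$ for $A\in\mathcal{B}$. $\angle(\widehat A,A_0)$ is the angle between the lines spanned by $\widehat A$ and $A_0$, i.e. $\sin\angle=\sqrt{1-|\langle\widehat A,A_0\rangle_F|^2}$. *)

theory Defs
  imports "HOL-Analysis.Analysis"
begin

definition cmat_scale :: "complex \<Rightarrow> complex^'n^'m \<Rightarrow> complex^'n^'m" where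
  "cmat_scale c A = (\<chi> i j. c * A $ i $ j)"

text \<open>Subspaces and spans of matrices over the complex scalars; the type class notions
  \<^const>\<open>subspace\<close> and \<^const>\<open>span\<close> are those of the underlying real vector space.\<close>

interpretation cmat: vector_space "cmat_scale :: complex \<Rightarrow> complex^'n^'m \<Rightarrow> complex^'n^'m"
  by unfold_locales (simp_all add: cmat_scale_def vec_eq_iff algebra_simps)

definition cadjoint :: "complex^'n^'m \<Rightarrow> complex^'m^'n" where
  "cadjoint A = (\<chi> i j. cnj (A $ j $ i))"

definition self_adjoint :: "complex^'n^'n \<Rightarrow> bool" where
  "self_adjoint A \<longleftrightarrow> cadjoint A = A"

definition commutator :: "complex^'n^'n \<Rightarrow> complex^'n^'n \<Rightarrow> complex^'n^'n" where
  "commutator X Y = X ** Y - Y ** X"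

definition frob_inner :: "complex^'n^'n \<Rightarrow> complex^'n^'n \<Rightarrow> complex" where
  "frob_inner X Y = trace (cadjoint X ** Y)"

definition frob_norm :: "complex^'n^'n \<Rightarrow> real" where
  "frob_norm X = sqrt (Re (frob_inner X X))"

text \<open>The operator norm with respect to the Euclidean norm of \<^typ>\<open>complex^'n\<close>.\<close>

definition op_norm :: "complex^'n^'n \<Rightarrow> real" where
  "op_norm A = onorm ((*v) A)"

text \<open>The Frobenius-orthogonal projection onto \<open>B\<close>, which is meaningful when \<open>B\<close> is a complex
  linear subspace.\<close>

definition frob_proj :: "(complex^'n^'n) set \<Rightarrow> complex^'n^'n \<Rightarrow> complex^'n^'n" where
  "frob_proj B X = (THE Y. Y \<in> B \<and> (\<forall>Z\<in>B. frob_inner Z (X - Y) = 0))"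

text \<open>Compressed double commutator. As an operator it is only considered on arguments in \<open>B\<close>: the
  kernel and the spectrum below refer to its restriction to \<open>B\<close>.\<close>

definition compressed_ad2 :: "(complex^'n^'n) set \<Rightarrow> complex^'n^'n \<Rightarrow> complex^'n^'n \<Rightarrow> complex^'n^'n" where
  "compressed_ad2 B R A = frob_proj B (commutator R (commutator R A))"

definition kernel_on :: "(complex^'n^'n) set \<Rightarrow> (complex^'n^'n \<Rightarrow> complex^'n^'n) \<Rightarrow> (complex^'n^'n) set" where
  "kernel_on B L = {A \<in> B. L A = 0}"

definition spectrum_on :: "(complex^'n^'n) set \<Rightarrow> (complex^'n^'n \<Rightarrow> complex^'n^'n) \<Rightarrow> complex set" where
  "spectrum_on B L = {k. \<exists>A\<in>B. A \<noteq> 0 \<and> L A = cmat_scale k A}"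

text \<open>The angle, in the interval from \<open>0\<close> to \<open>pi / 2\<close>, between the complex lines spanned by two
  nonzero matrices.\<close>

definition line_angle :: "complex^'n^'n \<Rightarrow> complex^'n^'n \<Rightarrow> real" where
  "line_angle X Y = arccos (cmod (frob_inner X Y) / (frob_norm X * frob_norm Y))"

lemma frob_inner_sum: "frob_inner X Y = (\<Sum>i\<in>UNIV. \<Sum>j\<in>UNIV. cnj (X $ i $ j) * Y $ i $ j)"
  unfolding frob_inner_def trace_def cadjoint_def matrix_matrix_mult_def
  by (simp, rule sum.swap)

lemma frob_norm_eq_norm: "frob_norm X = norm X"
proof -
  have "Re (frob_inner X X) = (\<Sum>i\<in>UNIV. \<Sum>j\<in>UNIV. (cmod (X $ i $ j))\<^sup>2)"
    by (simp add: frob_inner_sum cmod_power2) (simp add: power2_eq_square)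
  then show ?thesis
    by (simp add: frob_norm_def norm_vec_def L2_set_def sum_nonneg)
qed

lemma Re_frob_inner: "Re (frob_inner X Y) = X \<bullet> Y"
  by (simp add: frob_inner_sum inner_vec_def inner_complex_def)

lemma frob_inner_scale_left: "frob_inner (cmat_scale c X) Y = cnj c * frob_inner X Y"
  by (simp add: frob_inner_sum cmat_scale_def sum_distrib_left mult.assoc)

lemma frob_inner_diff_right: "frob_inner X (Y - Z) = frob_inner X Y - frob_inner X Z"
  by (simp add: frob_inner_sum algebra_simps sum_subtractf)

lemma norm_cmat_scale: "norm (cmat_scale c X) = cmod c * norm X"
proof -
  have "(\<Sum>i\<in>UNIV. \<Sum>j\<in>UNIV. (cmod c * cmod (X $ i $ j))\<^sup>2)
      = (cmod c)\<^sup>2 * (\<Sum>i\<in>UNIV. \<Sum>j\<in>UNIV. (cmod (X $ i $ j))\<^sup>2)"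
    by (simp add: power_mult_distrib sum_distrib_left)
  then show ?thesis
    by (simp add: cmat_scale_def norm_vec_def L2_set_def sum_nonneg norm_mult real_sqrt_mult)
qed

lemma frob_cauchy_schwarz: "cmod (frob_inner X Y) \<le> frob_norm X * frob_norm Y"
proof (cases "frob_inner X Y = 0")
  case True
  then show ?thesis by (simp add: frob_norm_eq_norm)
next
  case False
  define c where "c = sgn (frob_inner X Y)"
  have c: "cmod c = 1" using False by (simp add: c_def norm_sgn)
  have "cnj c * frob_inner X Y = of_real (cmod (frob_inner X Y))"
    using False unfolding c_def sgn_eq
    by (simp add: field_simps complex_norm_square[symmetric] power2_eq_square mult.commute)
  then have "cmod (frob_inner X Y) = Re (frob_inner (cmat_scale c X) Y)"
    by (simp add: frob_inner_scale_left)
  also have "\<dots> \<le> norm (cmat_scale c X) * norm Y"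
    by (simp only: Re_frob_inner norm_cauchy_schwarz)
  finally show ?thesis by (simp add: norm_cmat_scale c frob_norm_eq_norm)
qed

lemma sin_line_angle:
  assumes "frob_norm X = 1" "frob_norm Y = 1"
  shows "sin (line_angle X Y) = sqrt (1 - (cmod (frob_inner X Y))\<^sup>2)"
  using frob_cauchy_schwarz[of X Y] assms
  by (auto simp: line_angle_def intro!: sin_arccos order_trans[OF _ norm_ge_zero])

lemma frob_proj_ex1:
  assumes B: "cmat.subspace B"
  shows "\<exists>!Y. Y \<in> B \<and> (\<forall>Z\<in>B. frob_inner Z (X - Y) = 0)"
proof -
  have sc: "r *\<^sub>R A = cmat_scale (of_real r) A" for r and A :: "complex^'a^'a"
    by (simp add: cmat_scale_def vec_eq_iff scaleR_conv_of_real[where 'a = complex])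
  have "subspace B"
    using B unfolding subspace_def cmat.subspace_def by (auto simp: sc)
  then have sp: "span B = B" by (rule span_eq_iff[THEN iffD2])
  obtain Y W where Y: "Y \<in> B" and W: "\<And>Z. Z \<in> B \<Longrightarrow> orthogonal W Z" and X: "X = Y + W"
    using orthogonal_subspace_decomp_exists[of B X] unfolding sp by blast
  have re: "Re (frob_inner Z W) = 0" if "Z \<in> B" for Z
    using W[OF that] by (simp add: Re_frob_inner orthogonal_def inner_commute)
  have "frob_inner Z W = 0" if Z: "Z \<in> B" for Z
  proof (rule complex_eqI)
    have "cmat_scale \<i> Z \<in> B" using B Z by (rule cmat.subspace_scale)
    from re[OF this] show "Im (frob_inner Z W) = Im 0" by (simp add: frob_inner_scale_left)
  qed (simp add: re Z)
  then have ex: "\<forall>Z\<in>B. frob_inner Z (X - Y) = 0" using X by simp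
  have "V = Y" if V: "V \<in> B" "\<forall>Z\<in>B. frob_inner Z (X - V) = 0" for V
  proof -
    have d: "V - Y \<in> B" using B V(1) Y by (rule cmat.subspace_diff)
    have "frob_inner (V - Y) ((X - Y) - (X - V)) = 0"
      using d ex V(2) by (subst frob_inner_diff_right) simp
    then have "(V - Y) \<bullet> (V - Y) = 0" by (simp add: Re_frob_inner[symmetric])
    then show ?thesis by simp
  qed
  with Y ex show ?thesis by blast
qed

end

theory Submission
  imports Defs
begin

text \<open>
  Write \<open>w\<close> for the component of \<open>Ahat\<close> orthogonal to \<open>A0\<close>, so that \<open>s = norm w\<close> is the sine of the
  angle. As \<open>R\<close> commutes with \<open>A0\<close>, minimality of \<open>Ahat\<close> against the competitor \<open>A0\<close> yields
  \<open>norm [R, w] = norm [R, Ahat] \<le> norm [E, A0] + norm [E, Ahat] \<le> 4 e\<close> with \<open>e = op_norm E\<close>.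
  The gap gives \<open>\<gamma> * s\<^sup>2 \<le> (norm [R, w])\<^sup>2\<close>, and since \<open>norm [R, w] \<le> 2 * op_norm R * s\<close>, it also
  forces \<open>\<gamma> \<le> 4 * (op_norm R)\<^sup>2\<close> unless \<open>s = 0\<close>. Multiplying,
  \<open>(\<gamma> * s)\<^sup>2 \<le> (8 * op_norm R * e)\<^sup>2\<close>. No eigenvalue equation for \<open>Ahat\<close> is needed.
\<close>

text \<open>Compactness of the unit sphere of \<open>S\<close> provides a minimizer \<open>w\<close>
  of the Rayleigh quotient of \<open>T\<close>. The last conclusion is the first-variation equation:
  \<open>w\<close> is an eigenvector of the compression to \<open>S\<close> of the adjoint of
  \<open>T\<close> composed with \<open>T\<close>, stated without mentioning the adjoint.\<close>

lemma linear_min_on_unit_sphere: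
  fixes T :: "'a::euclidean_space \<Rightarrow> 'b::euclidean_space"
  assumes T: "linear T" and S: "subspace S" and x: "x \<in> S" "x \<noteq> 0"
  obtains w where "w \<in> S" "norm w = 1"
    "\<And>z. z \<in> S \<Longrightarrow> (norm (T w))\<^sup>2 * (norm z)\<^sup>2 \<le> (norm (T z))\<^sup>2"
    "\<And>z. z \<in> S \<Longrightarrow> T w \<bullet> T z = (norm (T w))\<^sup>2 * (w \<bullet> z)"
proof -
  have "compact (S \<inter> sphere 0 1)"
    using closed_subspace[OF S] by (simp add: closed_Int_compact)
  moreover have "x /\<^sub>R norm x \<in> S \<inter> sphere 0 1"
    using x S by (simp add: subspace_scale)
  moreover have "continuous_on (S \<inter> sphere 0 1) (\<lambda>z. norm (T z))"
    using T by (intro continuous_intros linear_continuous_on) (simp add: linear_conv_bounded_linear)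
  ultimately obtain w where w: "w \<in> S" "norm w = 1"
    and min: "\<And>y. y \<in> S \<Longrightarrow> norm y = 1 \<Longrightarrow> norm (T w) \<le> norm (T y)"
    using continuous_attains_inf[of "S \<inter> sphere 0 1" "\<lambda>z. norm (T z)"] by fastforce
  define k where "k = (norm (T w))\<^sup>2"
  have le: "k * (norm z)\<^sup>2 \<le> (norm (T z))\<^sup>2" if z: "z \<in> S" for z
  proof (cases "z = 0")
    case False
    have "norm (T w) \<le> norm (T (z /\<^sub>R norm z))"
      using False S z by (intro min) (simp_all add: subspace_scale)
    also have "\<dots> = norm (T z) / norm z"
      using T by (simp add: linear_scale divide_inverse mult.commute)
    finally have "norm (T w) * norm z \<le> norm (T z)"
      using False by (simp add: field_simps)
    then show ?thesis
      unfolding k_def by (metis norm_ge_zero power_mono power_mult_distrib mult_nonneg_nonneg)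
  qed simp
  have eq: "T w \<bullet> T z = k * (w \<bullet> z)" if z: "z \<in> S" for z
  proof (rule ccontr)
    define b where "b = T w \<bullet> T z - k * (w \<bullet> z)"
    define c where "c = (norm (T z))\<^sup>2 - k * (norm z)\<^sup>2"
    assume "T w \<bullet> T z \<noteq> k * (w \<bullet> z)"
    then have b: "b \<noteq> 0" by (simp add: b_def)
    have c: "c \<ge> 0" using le[OF z] by (simp add: c_def)
    \<comment> \<open>Perturb \<open>w\<close> to \<open>w + t *\<^sub>R z\<close> in
      \<open>le\<close>: the constant terms cancel, and a nonnegative quadratic in \<open>t\<close>
      without constant term cannot have a nonzero linear coefficient.\<close>
    have quad: "2 * t * b + t\<^sup>2 * c \<ge> 0" for t
    proof -
      have "k * (norm (w + t *\<^sub>R z))\<^sup>2 \<le> (norm (T (w + t *\<^sub>R z)))\<^sup>2"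
        using S w(1) z by (intro le) (simp add: subspace_add subspace_scale)
      moreover have "(norm (w + t *\<^sub>R z))\<^sup>2 = 1 + 2 * t * (w \<bullet> z) + t\<^sup>2 * (norm z)\<^sup>2"
        using w(2) unfolding power2_norm_eq_inner norm_eq_1
        by (simp add: inner_add_left inner_add_right inner_commute[of z w] power2_eq_square
            algebra_simps)
      moreover have "(norm (T (w + t *\<^sub>R z)))\<^sup>2 = k + 2 * t * (T w \<bullet> T z) + t\<^sup>2 * (norm (T z))\<^sup>2"
        using T unfolding k_def power2_norm_eq_inner
        by (simp add: linear_add linear_scale inner_add_left inner_add_right
            inner_commute[of "T z" "T w"] power2_eq_square algebra_simps)
      ultimately show ?thesis by (simp add: b_def c_def algebra_simps)
    qed
    \<comment> \<open>The vertex of the parabola is at \<open>- b / c\<close>, but \<open>c\<close>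
      may be zero; the denominator \<open>c + 1\<close> is positive and still yields a negative
      value.\<close>
    have "2 * (- b / (c + 1)) * b + (- b / (c + 1))\<^sup>2 * c = - (b / (c + 1))\<^sup>2 * (c + 2)"
      using c by (simp add: divide_simps power2_eq_square) (simp add: algebra_simps)
    also have "\<dots> < 0" using b c by (simp add: mult_pos_pos)
    finally show False using quad[of "- b / (c + 1)"] by simp
  qed
  show thesis using that w le eq unfolding k_def by blast
qed

section \<open>Norm bounds and linearity of the commutator\<close>

lemma norm_cadjoint: "norm (cadjoint A) = norm A"
  for A :: "complex^'n^'n"
proof -
  have "(\<Sum>i\<in>UNIV. \<Sum>j\<in>UNIV. (cmod (A $ j $ i))\<^sup>2) = (\<Sum>i\<in>UNIV. \<Sum>j\<in>UNIV. (cmod (A $ i $ j))\<^sup>2)"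
    by (rule sum.swap)
  then show ?thesis
    by (simp add: cadjoint_def norm_vec_def L2_set_def sum_nonneg)
qed

lemma cadjoint_mult: "cadjoint (A ** B) = cadjoint B ** cadjoint A"
  by (simp add: cadjoint_def matrix_matrix_mult_def vec_eq_iff mult.commute)

lemma cadjoint_diff: "cadjoint (A - B) = cadjoint A - cadjoint B"
  by (simp add: cadjoint_def vec_eq_iff)

lemma bounded_linear_cmat_vec: "bounded_linear ((*v) A)"
  for A :: "complex^'n^'m"
  by (rule matrix_vector_mul_bounded_linear)

lemma op_norm_nonneg: "0 \<le> op_norm A"
  unfolding op_norm_def by (rule onorm_pos_le[OF bounded_linear_cmat_vec])

text \<open>Left multiplication by \<open>X\<close> acts on each column of \<open>A\<close>
  separately, and the squared Frobenius norm is the sum of the squared column norms.\<close>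

lemma norm_mult_le_op_norm: "norm (X ** A) \<le> op_norm X * norm A"
  for A X :: "complex^'n^'n"
proof -
  have cols: "(norm M)\<^sup>2 = (\<Sum>j\<in>UNIV. (norm (column j M))\<^sup>2)" for M :: "complex^'n^'n"
    by (subst norm_cadjoint[symmetric])
      (simp add: norm_vec_def L2_set_def sum_nonneg cadjoint_def column_def)
  have "(norm (X ** A))\<^sup>2 = (\<Sum>j\<in>UNIV. (norm (X *v column j A))\<^sup>2)"
    by (simp add: cols column_def matrix_matrix_mult_def matrix_vector_mult_def)
  also have "\<dots> \<le> (\<Sum>j\<in>UNIV. (op_norm X * norm (column j A))\<^sup>2)"
    unfolding op_norm_def
    by (intro sum_mono power_mono onorm[OF bounded_linear_cmat_vec]) simp
  also have "\<dots> = (op_norm X * norm A)\<^sup>2"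
    by (simp add: cols power_mult_distrib sum_distrib_left)
  finally show ?thesis
    by (rule power2_le_imp_le) (simp add: op_norm_nonneg)
qed

text \<open>Since \<open>X\<close> is self-adjoint, \<open>A ** X\<close> is the adjoint of
  \<open>X ** cadjoint A\<close>, so the bound for left multiplication covers both terms.\<close>

lemma norm_commutator_le:
  assumes "self_adjoint X"
  shows "norm (commutator X A) \<le> 2 * op_norm X * norm A"
proof -
  have "norm (A ** X) = norm (X ** cadjoint A)"
    using norm_cadjoint[of "A ** X"] assms by (simp add: cadjoint_mult self_adjoint_def)
  also have "\<dots> \<le> op_norm X * norm A"
    using norm_mult_le_op_norm[of X "cadjoint A"] by (simp add: norm_cadjoint)
  finally show ?thesis
    using norm_mult_le_op_norm[of X A] norm_triangle_ineq4[of "X ** A" "A ** X"]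
    by (simp add: commutator_def)
qed

lemma commutator_add_left: "commutator (X + Y) A = commutator X A + commutator Y A"
  by (simp add: commutator_def vec_eq_iff matrix_matrix_mult_def sum.distrib algebra_simps)

lemma commutator_diff_right: "commutator X (A - C) = commutator X A - commutator X C"
  by (simp add: commutator_def vec_eq_iff matrix_matrix_mult_def sum_subtractf algebra_simps)

lemma commutator_scale_right: "commutator X (cmat_scale c A) = cmat_scale c (commutator X A)"
  by (simp add: commutator_def cmat_scale_def vec_eq_iff matrix_matrix_mult_def sum_distrib_left
      algebra_simps)

lemma scaleR_eq_cmat_scale: "r *\<^sub>R A = cmat_scale (of_real r) A"
  by (simp add: cmat_scale_def vec_eq_iff scaleR_conv_of_real[where 'a = complex])

lemma linear_commutator: "linear (commutator X)"
proof (rule linearI)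
  show "commutator X (A + C) = commutator X A + commutator X C" for A C
    by (simp add: commutator_def vec_eq_iff matrix_matrix_mult_def sum.distrib algebra_simps)
  show "commutator X (r *\<^sub>R A) = r *\<^sub>R commutator X A" for r A
    by (simp add: scaleR_eq_cmat_scale commutator_scale_right)
qed

lemma cmat_subspace_imp_subspace: "cmat.subspace B \<Longrightarrow> subspace B"
  unfolding subspace_def cmat.subspace_def by (auto simp: scaleR_eq_cmat_scale)

section \<open>The compressed double commutator and its spectral gap\<close>

lemma matrix_mult_diff_left: "(A - B) ** C = A ** C - B ** C"
  for A B :: "'a::ring_1^'n^'m"
  by (simp add: matrix_matrix_mult_def vec_eq_iff left_diff_distrib sum_subtractf)

lemma matrix_mult_diff_right: "A ** (B - C) = A ** B - A ** C"
  for A :: "'a::ring_1^'n^'m"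
  by (simp add: matrix_matrix_mult_def vec_eq_iff right_diff_distrib sum_subtractf)

text \<open>Cyclicity of the trace moves \<open>R\<close> around the product.\<close>

lemma frob_inner_commutator:
  assumes "self_adjoint R"
  shows "frob_inner X (commutator R Y) = frob_inner (commutator R X) Y"
proof -
  have "trace (cadjoint X ** (Y ** R)) = trace (R ** (cadjoint X ** Y))"
    by (metis matrix_mul_assoc trace_mul_sym)
  then show ?thesis
    using assms
    by (simp add: frob_inner_def commutator_def cadjoint_diff cadjoint_mult self_adjoint_def
        matrix_mult_diff_left matrix_mult_diff_right trace_sub matrix_mul_assoc)
qed

lemma frob_inner_commute: "frob_inner X Y = cnj (frob_inner Y X)"
  by (simp add: frob_inner_sum mult.commute)

lemma frob_inner_scale_right: "frob_inner X (cmat_scale c Y) = c * frob_inner X Y"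
  by (simp add: frob_inner_sum cmat_scale_def sum_distrib_left algebra_simps)

lemma frob_inner_add_right: "frob_inner X (Y + Z) = frob_inner X Y + frob_inner X Z"
  by (simp add: frob_inner_sum algebra_simps sum.distrib)

lemma frob_inner_self: "frob_inner X X = of_real ((norm X)\<^sup>2)"
proof (rule complex_eqI)
  show "Re (frob_inner X X) = Re (of_real ((norm X)\<^sup>2))"
    by (simp add: Re_frob_inner power2_norm_eq_inner)
  show "Im (frob_inner X X) = Im (of_real ((norm X)\<^sup>2))"
    using arg_cong[OF frob_inner_commute[of X X], of Im] by simp
qed

text \<open>A complex subspace is stable under multiplication by \<open>\<i>\<close>, which recovers the imaginary part.\<close>

lemma frob_inner_eq_0_if_inner_eq_0:
  assumes "cmat.subspace B" and "\<And>Z. Z \<in> B \<Longrightarrow> Z \<bullet> W = 0" and "Z \<in> B"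
  shows "frob_inner Z W = 0"
proof (rule complex_eqI)
  have "cmat_scale \<i> Z \<in> B" using assms(1,3) by (rule cmat.subspace_scale)
  from assms(2)[OF this] show "Im (frob_inner Z W) = Im 0"
    by (simp add: Re_frob_inner[symmetric] frob_inner_scale_left)
qed (simp add: Re_frob_inner assms)

text \<open>Orthogonality is tested with the real inner product only, the form in which a
  variational argument over the reals delivers it.\<close>

lemma frob_proj_eqI:
  assumes "cmat.subspace B" "Y \<in> B" "\<And>Z. Z \<in> B \<Longrightarrow> Z \<bullet> (X - Y) = 0"
  shows "frob_proj B X = Y"
  unfolding frob_proj_def
  using frob_inner_eq_0_if_inner_eq_0[OF assms(1,3)] assms(2)
  by (intro the1_equality[OF frob_proj_ex1[OF assms(1)]]) blast

lemma frob_proj_orthogonal: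
  assumes "cmat.subspace B" "Z \<in> B"
  shows "frob_inner Z (X - frob_proj B X) = 0"
  using theI'[OF frob_proj_ex1[OF assms(1), of X]] assms(2) unfolding frob_proj_def by blast

text \<open>Pairing with \<open>A\<close> in \<open>B\<close> does not see the projection, and one
  commutator moves to the other side of the inner product.\<close>

lemma frob_inner_compressed_ad2:
  assumes "self_adjoint R" "cmat.subspace B" "A \<in> B"
  shows "frob_inner A (compressed_ad2 B R A) = of_real ((norm (commutator R A))\<^sup>2)"
  using frob_proj_orthogonal[OF assms(2,3), of "commutator R (commutator R A)"]
  by (simp add: compressed_ad2_def frob_inner_diff_right frob_inner_commutator[OF assms(1)]
      frob_inner_self)

lemma commutator_eq_0_if_compressed_ad2_eq_0:
  assumes "self_adjoint R" "cmat.subspace B" "A \<in> B" "compressed_ad2 B R A = 0"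
  shows "commutator R A = 0"
  using frob_inner_compressed_ad2[OF assms(1-3)] assms(4) frob_inner_diff_right[of A 0 0] by simp

text \<open>The minimum \<open>k\<close> of the Rayleigh quotient on the orthogonal complement of
  \<open>A0\<close> in \<open>B\<close> is an eigenvalue of the compressed operator. Its eigenvector
  is orthogonal to the kernel, so \<open>k\<close> is nonzero and the gap hypothesis applies to
  it.\<close>

lemma gap_le_norm_commutator:
  fixes R A0 :: "complex^'n^'n"
  assumes R: "self_adjoint R" and B: "cmat.subspace B"
    and ker: "kernel_on B (compressed_ad2 B R) = cmat.span {A0}"
    and A0: "norm A0 = 1"
    and gap: "\<forall>k \<in> spectrum_on B (compressed_ad2 B R) - {0}. \<gamma> \<le> cmod k"
    and w: "w \<in> B" "frob_inner A0 w = 0"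
  shows "\<gamma> * (norm w)\<^sup>2 \<le> (norm (commutator R w))\<^sup>2"
proof (cases "w = 0")
  case False
  have A0B: "A0 \<in> B" and LA0: "compressed_ad2 B R A0 = 0"
    using cmat.span_base[of A0 "{A0}"] ker by (auto simp: kernel_on_def)
  have RA0: "commutator R A0 = 0"
    using commutator_eq_0_if_compressed_ad2_eq_0 R B A0B LA0 .
  define S where "S = {z \<in> B. frob_inner A0 z = 0}"
  have "frob_inner A0 0 = 0" using frob_inner_diff_right[of A0 0 0] by simp
  then have "cmat.subspace S"
    using B unfolding S_def cmat.subspace_def
    by (auto simp: frob_inner_add_right frob_inner_scale_right)
  then have S: "subspace S" by (rule cmat_subspace_imp_subspace)
  have wS: "w \<in> S" using w by (simp add: S_def)
  obtain v where v: "v \<in> S" "norm v = 1"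
    and le: "\<And>z. z \<in> S \<Longrightarrow> (norm (commutator R v))\<^sup>2 * (norm z)\<^sup>2 \<le> (norm (commutator R z))\<^sup>2"
    and eq: "\<And>z. z \<in> S \<Longrightarrow>
      commutator R v \<bullet> commutator R z = (norm (commutator R v))\<^sup>2 * (v \<bullet> z)"
    using linear_min_on_unit_sphere[OF linear_commutator S wS False] by metis
  define k where "k = (norm (commutator R v))\<^sup>2"
  have vB: "v \<in> B" and A0v: "frob_inner A0 v = 0" using v by (auto simp: S_def)
  \<comment> \<open>The variational identity holds for test matrices in \<open>S\<close> only.
    Removing from \<open>Z\<close> its \<open>A0\<close> component lands in \<open>S\<close> and
    changes neither side: \<open>A0\<close> commutes with \<open>R\<close> and is orthogonal to
    \<open>v\<close>.\<close>
  have "Z \<bullet> (commutator R (commutator R v) - cmat_scale (of_real k) v) = 0" if Z: "Z \<in> B" for Z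
  proof -
    define c where "c = frob_inner A0 Z"
    define y where "y = Z - cmat_scale c A0"
    have "frob_inner A0 y = 0"
      by (simp add: y_def frob_inner_diff_right frob_inner_scale_right frob_inner_self A0 c_def)
    moreover have "y \<in> B"
      unfolding y_def by (intro cmat.subspace_diff cmat.subspace_scale B Z A0B)
    ultimately have "commutator R v \<bullet> commutator R y = k * (v \<bullet> y)"
      unfolding k_def by (intro eq) (simp add: S_def)
    moreover have "commutator R y = commutator R Z"
      by (simp add: y_def commutator_diff_right commutator_scale_right RA0)
    moreover have "cmat_scale c A0 \<bullet> v = 0"
      by (simp add: Re_frob_inner[symmetric] frob_inner_scale_left A0v)
    then have "v \<bullet> y = v \<bullet> Z"
      by (simp add: y_def inner_diff_right inner_commute)
    moreover have "Z \<bullet> commutator R (commutator R v) = commutator R Z \<bullet> commutator R v"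
      by (simp only: Re_frob_inner[symmetric] frob_inner_commutator[OF R])
    ultimately show ?thesis
      by (simp add: inner_diff_right scaleR_eq_cmat_scale[symmetric] inner_commute)
  qed
  then have Lv: "compressed_ad2 B R v = cmat_scale (of_real k) v"
    unfolding compressed_ad2_def using B vB by (intro frob_proj_eqI cmat.subspace_scale) auto
  have "k \<noteq> 0"
  proof
    assume "k = 0"
    then have "v \<in> cmat.span {A0}"
      unfolding ker[symmetric] kernel_on_def using Lv vB by simp
    then obtain c where c: "v = cmat_scale c A0"
      by (auto simp: cmat.span_singleton)
    then have "c = 0"
      using A0v by (simp add: frob_inner_scale_right frob_inner_self A0)
    then show False using c v(2) by simp
  qed
  moreover have "of_real k \<in> spectrum_on B (compressed_ad2 B R)"
    unfolding spectrum_on_def using Lv vB v(2) by (auto intro!: bexI[of _ v])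
  ultimately have "\<gamma> \<le> cmod (of_real k)"
    by (intro bspec[OF gap]) simp
  moreover have "k \<ge> 0" by (simp add: k_def)
  ultimately have "\<gamma> \<le> k" by simp
  then have "\<gamma> * (norm w)\<^sup>2 \<le> k * (norm w)\<^sup>2" by (simp add: mult_right_mono)
  also have "\<dots> \<le> (norm (commutator R w))\<^sup>2" unfolding k_def by (rule le[OF wS])
  finally show ?thesis .
qed simp

section \<open>Perturbation bound for the minimizer \<open>Ahat\<close>\<close>

theorem theorem9p1:
  fixes R E A0 Ahat :: "complex^'n^'n"
    and B :: "(complex^'n^'n) set"
    and \<gamma> :: real
  assumes "self_adjoint R"
    and "cmat.subspace B"
    and "kernel_on B (compressed_ad2 B R) = cmat.span {A0}"
    and "frob_norm A0 = 1"
    and "\<gamma> > 0"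
    and "\<forall>k \<in> spectrum_on B (compressed_ad2 B R) - {0}. \<gamma> \<le> cmod k"
    and "self_adjoint E"
    and "is_arg_min (\<lambda>A. (frob_norm (commutator (R + E) A))\<^sup>2)
           (\<lambda>A. A \<in> B \<and> frob_norm A = 1) Ahat"
    and "8 * op_norm R * op_norm E + 4 * (op_norm E)\<^sup>2 < \<gamma> / 2"
  shows "sin (line_angle Ahat A0)
           \<le> (8 * op_norm R * op_norm E + 4 * (op_norm E)\<^sup>2)
              / (\<gamma> - 8 * op_norm R * op_norm E - 4 * (op_norm E)\<^sup>2)"
proof -
  note R = assms(1) and B = assms(2) and ker = assms(3) and E = assms(7)
  have A0: "norm A0 = 1" using assms(4) by (simp add: frob_norm_eq_norm)
  have A0B: "A0 \<in> B" and LA0: "compressed_ad2 B R A0 = 0"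
    using cmat.span_base[of A0 "{A0}"] ker by (auto simp: kernel_on_def)
  have RA0: "commutator R A0 = 0"
    using commutator_eq_0_if_compressed_ad2_eq_0 R B A0B LA0 .
  have AB: "Ahat \<in> B" and A1: "norm Ahat = 1"
    and "(frob_norm (commutator (R + E) Ahat))\<^sup>2 \<le> (frob_norm (commutator (R + E) A0))\<^sup>2"
    using assms(8) A0B assms(4) by (auto simp: is_arg_min_linorder frob_norm_eq_norm)
  then have min: "norm (commutator (R + E) Ahat) \<le> norm (commutator E A0)"
    by (simp add: frob_norm_eq_norm commutator_add_left RA0)
  define r e where "r = op_norm R" and "e = op_norm E"
  have r: "r \<ge> 0" and e: "e \<ge> 0" by (simp_all add: r_def e_def op_norm_nonneg)
  define c where "c = frob_inner A0 Ahat"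
  define w where "w = Ahat - cmat_scale c A0"
  have A0w: "frob_inner A0 w = 0"
    by (simp add: w_def frob_inner_diff_right frob_inner_scale_right frob_inner_self A0 c_def)
  \<comment> \<open>The sum is \<open>Ahat\<close>, of norm 1, so Pythagoras identifies
    \<open>norm w\<close> with the sine of the angle.\<close>
  have "(norm (cmat_scale c A0 + w))\<^sup>2 = (norm (cmat_scale c A0))\<^sup>2 + (norm w)\<^sup>2"
    by (rule norm_add_Pythagorean)
      (simp add: orthogonal_def Re_frob_inner[symmetric] frob_inner_scale_left A0w)
  then have "(norm w)\<^sup>2 = 1 - (cmod c)\<^sup>2"
    by (simp add: w_def norm_cmat_scale A0 A1)
  moreover have "cmod (frob_inner Ahat A0) = cmod c"
    by (metis c_def complex_mod_cnj frob_inner_commute)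
  ultimately have sin: "sin (line_angle Ahat A0) = norm w"
    using assms(4) A1 by (simp add: sin_line_angle frob_norm_eq_norm real_sqrt_unique)
  have wB: "w \<in> B"
    unfolding w_def by (intro cmat.subspace_diff cmat.subspace_scale B AB A0B)
  have gap: "\<gamma> * (norm w)\<^sup>2 \<le> (norm (commutator R w))\<^sup>2"
    using gap_le_norm_commutator R B ker A0 assms(6) wB A0w .
  have "commutator R w = commutator (R + E) Ahat - commutator E Ahat"
    by (simp add: w_def commutator_diff_right commutator_scale_right RA0 commutator_add_left)
  then have "norm (commutator R w) \<le> norm (commutator (R + E) Ahat) + norm (commutator E Ahat)"
    by (simp only: norm_triangle_ineq4)
  also have "\<dots> \<le> 4 * e"
    using min norm_commutator_le[OF E, of A0] norm_commutator_le[OF E, of Ahat]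
    by (simp add: A0 A1 e_def)
  finally have upper: "(norm (commutator R w))\<^sup>2 \<le> (4 * e)\<^sup>2"
    by (rule power_mono) simp
  have "\<gamma> * norm w \<le> 8 * r * e"
  proof (cases "norm w = 0")
    case True
    then show ?thesis using r e by simp
  next
    case False
    have "(norm (commutator R w))\<^sup>2 \<le> (2 * r * norm w)\<^sup>2"
      using norm_commutator_le[OF R, of w] unfolding r_def by (rule power_mono) simp
    then have "\<gamma> * (norm w)\<^sup>2 \<le> (2 * r)\<^sup>2 * (norm w)\<^sup>2"
      using gap by (simp add: power_mult_distrib)
    then have "\<gamma> \<le> (2 * r)\<^sup>2" using False by simp
    \<comment> \<open>One factor \<gamma> is bounded through \<open>R\<close>, the other through
      \<open>E\<close>; the constant 8 below is the product of 2 from \<open>2 * r\<close> and 4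
      from \<open>4 * e\<close>.\<close>
    then have "\<gamma> * (\<gamma> * (norm w)\<^sup>2) \<le> (2 * r)\<^sup>2 * (4 * e)\<^sup>2"
      using gap upper \<open>\<gamma> > 0\<close> by (intro mult_mono) auto
    then have "(\<gamma> * norm w)\<^sup>2 \<le> (8 * r * e)\<^sup>2"
      by (simp add: power2_eq_square algebra_simps)
    then show ?thesis by (rule power2_le_imp_le) (simp add: r e)
  qed
  define \<delta> where "\<delta> = 8 * r * e + 4 * e\<^sup>2"
  have \<delta>: "8 * r * e \<le> \<delta>" "0 \<le> \<delta>" "\<delta> < \<gamma> / 2"
    using r e assms(9) by (simp_all add: \<delta>_def r_def e_def)
  \<comment> \<open>The bound \<open>8 * r * e\<close> for \<open>\<gamma> * norm w\<close> is
    weakened to the stated form: \<gamma> shrinks to \<open>\<gamma> - \<delta>\<close>, which is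
    positive as \<delta> is below half of \<gamma>, and \<open>8 * r * e\<close> grows to
    \<delta>.\<close>
  have "(\<gamma> - \<delta>) * norm w \<le> \<gamma> * norm w"
    using \<delta> by (intro mult_right_mono) auto
  also have "\<dots> \<le> \<delta>" using \<open>\<gamma> * norm w \<le> 8 * r * e\<close> \<delta> by linarith
  finally have "norm w \<le> \<delta> / (\<gamma> - \<delta>)"
    using \<delta> \<open>\<gamma> > 0\<close> by (simp add: pos_le_divide_eq mult.commute)
  then show ?thesis by (simp add: sin \<delta>_def r_def e_def algebra_simps)
qed

end
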